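(* Let $X_1,\dots,X_n$ be independent zero mean random variables, $X_i$ being sub-exponential with parameters $(\sigma_i^2,b_i)$. Denote $V_0^2=\sum_i\sigma_i^2$ and $b=\max_ib_i$, and let $M>0$. Then the random variable $$Z=\sup_{\substack{\Gamma\in\mathbb R^n\\\|\Gamma\|_\infty\le M}}\ \sum_i\Gamma_iX_i$$ is also sub-exponential with parameters $(8M^2V_0^2,\,2\sqrt2\,Mb)$. Moreover $\mathbb E[Z]\le MV_0\sqrt n$, so that for all $t>0$, $$\mathbb P\bigl(Z-MV_0\sqrt n\ge t\bigr)\le\exp\left(-\frac{t^2}{2\,(8M^2V_0^2+2\sqrt2\,Mb\,t)}\right).$$
   Context: A random variable $X$ is sub-exponential with parameters $(\tau^2,b)$ if for all $\lambda$ with $|\lambda|\le1/b$, $\mathbb E[e^{\lambda(X-\mathbb E X)}]\le\exp(\lambda^2\tau^2/2)$. *)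

theory Defs
  imports "HOL-Probability.Probability"
begin

text \<open>
  The first parameter \<open>v\<close> plays the role of \<open>\<tau>\<^sup>2\<close>. Positivity of \<open>b\<close> makes the range
  \<open>\<bar>l\<bar> \<le> 1 / b\<close> meaningful, since \<open>1 / 0 = 0\<close> here. The Bochner integral of a
  non-integrable function is \<open>0\<close>, so existence of the mean and finiteness of the
  exponential moments, implicit in the usual inequality, are required explicitly.
\<close>
definition sub_exponential :: "'a measure \<Rightarrow> ('a \<Rightarrow> real) \<Rightarrow> real \<Rightarrow> real \<Rightarrow> bool" where
  "sub_exponential P X v b \<longleftrightarrow>
     0 < b \<and> integrable P X \<and>
     (\<forall>l. \<bar>l\<bar> \<le> 1 / b \<longrightarrow>
        integrable P (\<lambda>\<omega>. exp (l * (X \<omega> - integral\<^sup>L P X))) \<and>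
        integral\<^sup>L P (\<lambda>\<omega>. exp (l * (X \<omega> - integral\<^sup>L P X))) \<le> exp (l\<^sup>2 * v / 2))"

end

theory Submission
  imports Defs "HOL-Real_Asymp.Real_Asymp"
begin

text \<open>
  The supremum is \<open>M\<close> times the \<open>\<ell>\<^sub>1\<close> norm of \<open>X\<close>, so everything reduces to \<open>\<bar>X\<^sub>i\<bar>\<close>.
  By Jensen, \<open>E exp (l (\<bar>X\<bar> - E \<bar>X\<bar>)) \<le> E exp (l \<bar>X\<bar>) * E exp (- l \<bar>X\<bar>)\<close>. Writing
  \<open>exp = cosh + sinh\<close>, this product is \<open>C\<^sup>2 - S\<^sup>2\<close> with \<open>C = E cosh (l X)\<close> and
  \<open>S = E sinh (l \<bar>X\<bar>)\<close>; since \<open>\<bar>E sinh (l X)\<bar> \<le> \<bar>S\<bar>\<close>, it is at most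
  \<open>E exp (l X) * E exp (- l X) \<le> exp (l\<^sup>2 v)\<close>. Hence \<open>\<bar>X\<bar>\<close> is sub-exponential with
  parameters \<open>(2 v, b)\<close>, which is better than the claim requires. The mean of \<open>\<bar>X\<^sub>i\<bar>\<close> is
  bounded by \<open>\<sigma>\<^sub>i\<close> by expanding the moment generating function to second order at \<open>0\<close>.
\<close>

section \<open>Growth of cosh near zero\<close>

lemma two_plus_square_le_exp_plus_exp_minus:
  fixes x :: real
  shows "2 + x\<^sup>2 \<le> exp x + exp (- x)"
proof -
  have sinh_ge: "y \<le> sinh y" if "0 \<le> y" for y :: real
  proof -
    have "(\<lambda>u. sinh u - u) 0 \<le> (\<lambda>u. sinh u - u) y"
      by (rule DERIV_nonneg_imp_nondecreasing[OF that])
         (auto intro!: derivative_eq_intros exI simp: cosh_real_ge_1)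
    then show ?thesis by simp
  qed
  \<comment> \<open>The argument is halved because cosh x = 1 + 2 sinh^2 (x / 2): squaring this
    first-order bound then gives the quadratic bound on cosh.\<close>
  have "\<bar>x / 2\<bar> \<le> \<bar>sinh (x / 2)\<bar>"
    using sinh_ge[of "\<bar>x / 2\<bar>"] by (simp only: sinh_real_abs abs_ge_zero)
  then have "(x / 2)\<^sup>2 \<le> (sinh (x / 2))\<^sup>2"
    by (simp only: abs_le_square_iff)
  moreover have "cosh x = 1 + 2 * (sinh (x / 2))\<^sup>2"
    using cosh_double[of "x / 2"] cosh_square_eq[of "x / 2"] by simp
  ultimately show ?thesis
    by (simp add: cosh_field_def field_simps power2_eq_square)
qed

section \<open>Monotonicity, scaling and independent sums\<close>

lemma sub_exponential_mono:
  assumes "sub_exponential P X v b" "v \<le> v'" "b \<le> b'"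
  shows "sub_exponential P X v' b'"
proof -
  have b: "0 < b" using assms(1) by (simp add: sub_exponential_def)
  have "\<bar>l\<bar> \<le> 1 / b" if "\<bar>l\<bar> \<le> 1 / b'" for l
    using that b assms(3) by (smt (verit) frac_le)
  moreover have "exp (l\<^sup>2 * v / 2) \<le> exp (l\<^sup>2 * v' / 2)" for l
    using assms(2) by (simp add: mult_left_mono)
  ultimately show ?thesis
    using assms b unfolding sub_exponential_def by (meson less_le_trans order_trans)
qed

lemma sub_exponential_cmult:
  assumes X: "sub_exponential P X v b" and c: "0 < c"
  shows "sub_exponential P (\<lambda>\<omega>. c * X \<omega>) (c\<^sup>2 * v) (c * b)"
proof -
  have eq: "l * (c * X \<omega> - integral\<^sup>L P (\<lambda>\<omega>. c * X \<omega>)) = (l * c) * (X \<omega> - integral\<^sup>L P X)"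
    for l \<omega> by (simp add: algebra_simps)
  have bound: "\<bar>l * c\<bar> \<le> 1 / b" if "\<bar>l\<bar> \<le> 1 / (c * b)" for l
    using that c X by (simp add: sub_exponential_def abs_mult field_simps)
  have v: "l\<^sup>2 * (c\<^sup>2 * v) / 2 = (l * c)\<^sup>2 * v / 2" for l
    by (simp add: power_mult_distrib)
  show ?thesis
    using X c bound unfolding sub_exponential_def eq v by simp
qed

text \<open>Independence turns the centred exponential moment of the sum into a product, and the
  exponents of the factor bounds add up. Since \<open>B\<close> dominates every \<open>b i\<close>,
  a single \<open>l\<close> with \<open>\<bar>l\<bar> \<le> 1 / B\<close> is admissible for all
  factors at once.\<close>

lemma (in prob_space) sub_exponential_sum:
  assumes I: "finite I" and indep: "indep_vars (\<lambda>_. borel) X I"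
    and X: "\<And>i. i \<in> I \<Longrightarrow> sub_exponential M (X i) (v i) (b i)"
    and B: "0 < B" "\<And>i. i \<in> I \<Longrightarrow> b i \<le> B"
  shows "sub_exponential M (\<lambda>\<omega>. \<Sum>i\<in>I. X i \<omega>) (\<Sum>i\<in>I. v i) B"
proof -
  have int: "integrable M (X i)" if "i \<in> I" for i
    using X[OF that] by (simp add: sub_exponential_def)
  have "integrable M (\<lambda>\<omega>. exp (l * ((\<Sum>i\<in>I. X i \<omega>) - expectation (\<lambda>\<omega>. \<Sum>i\<in>I. X i \<omega>))))
      \<and> expectation (\<lambda>\<omega>. exp (l * ((\<Sum>i\<in>I. X i \<omega>) - expectation (\<lambda>\<omega>. \<Sum>i\<in>I. X i \<omega>))))
        \<le> exp (l\<^sup>2 * (\<Sum>i\<in>I. v i) / 2)" if l: "\<bar>l\<bar> \<le> 1 / B" for l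
  proof -
    define Y where "Y i \<omega> = exp (l * (X i \<omega> - expectation (X i)))" for i \<omega>
    have prod: "exp (l * ((\<Sum>i\<in>I. X i \<omega>) - expectation (\<lambda>\<omega>. \<Sum>i\<in>I. X i \<omega>))) = (\<Prod>i\<in>I. Y i \<omega>)"
      for \<omega>
      using I int by (simp add: Y_def exp_sum[symmetric] sum_distrib_left[symmetric] sum_subtractf)
    have Y: "integrable M (Y i) \<and> expectation (Y i) \<le> exp (l\<^sup>2 * v i / 2)" if "i \<in> I" for i
      using sub_exponential_mono[OF X[OF that] order_refl B(2)[OF that]] l
      unfolding sub_exponential_def Y_def by blast
    have Yind: "indep_vars (\<lambda>_. borel) Y I"
      unfolding Y_def using indep by (rule indep_vars_compose2) measurable
    have "expectation (\<lambda>\<omega>. \<Prod>i\<in>I. Y i \<omega>) = (\<Prod>i\<in>I. expectation (Y i))"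
      using I Yind Y by (intro indep_vars_lebesgue_integral) auto
    also have "\<dots> \<le> (\<Prod>i\<in>I. exp (l\<^sup>2 * v i / 2))"
      using Y by (intro prod_mono) (auto simp: Y_def)
    also have "\<dots> = exp (l\<^sup>2 * (\<Sum>i\<in>I. v i) / 2)"
      using I by (simp add: exp_sum[symmetric] sum_distrib_left sum_divide_distrib)
    finally show ?thesis
      unfolding prod using indep_vars_integrable[OF I Yind] Y by blast
  qed
  then show ?thesis
    using int B(1) unfolding sub_exponential_def by auto
qed

section \<open>Absolute value of a centred variable: exponential moments and mean\<close>

lemma (in prob_space) sub_exponential_abs:
  assumes X: "sub_exponential M X v b" and mean: "expectation X = 0"
  shows "sub_exponential M (\<lambda>\<omega>. \<bar>X \<omega>\<bar>) (2 * v) b"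
proof -
  have b: "0 < b" and int: "integrable M X"
    using X by (auto simp: sub_exponential_def)
  have mgf: "integrable M (\<lambda>\<omega>. exp (l * X \<omega>))"
      "expectation (\<lambda>\<omega>. exp (l * X \<omega>)) \<le> exp (l\<^sup>2 * v / 2)" if "\<bar>l\<bar> \<le> 1 / b" for l
    using X mean that unfolding sub_exponential_def by auto
  let ?m = "expectation (\<lambda>\<omega>. \<bar>X \<omega>\<bar>)"
  have "integrable M (\<lambda>\<omega>. exp (l * (\<bar>X \<omega>\<bar> - ?m)))
      \<and> expectation (\<lambda>\<omega>. exp (l * (\<bar>X \<omega>\<bar> - ?m))) \<le> exp (l\<^sup>2 * (2 * v) / 2)"
    if l: "\<bar>l\<bar> \<le> 1 / b" for l
  proof -
    note [measurable] = borel_measurable_integrable[OF int]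
    define C where "C = expectation (\<lambda>\<omega>. cosh (l * X \<omega>))"
    define s where "s = expectation (\<lambda>\<omega>. sinh (l * X \<omega>))"
    define S where "S = expectation (\<lambda>\<omega>. sinh (l * \<bar>X \<omega>\<bar>))"
    have e1: "integrable M (\<lambda>\<omega>. exp (l * X \<omega>))" and e2: "integrable M (\<lambda>\<omega>. exp (- (l * X \<omega>)))"
      using mgf(1)[of l] mgf(1)[of "- l"] l by auto
    have ic: "integrable M (\<lambda>\<omega>. cosh (l * X \<omega>))" and is': "integrable M (\<lambda>\<omega>. sinh (l * X \<omega>))"
      unfolding cosh_field_def sinh_field_def using e1 e2 by auto
    \<comment> \<open>As sinh is odd and has the sign of its argument, \<open>sgn l\<close> is the
      only correction needed; for \<open>l = 0\<close> both sides vanish. This is what lets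
      \<open>s\<close> be compared with \<open>S\<close>.\<close>
    have sinh_mult_abs: "\<bar>sinh (l * x)\<bar> = sgn l * sinh (l * \<bar>x\<bar>)" for x
      by (cases "0 \<le> x"; cases "l > 0"; cases "l = 0")
         (auto simp: sgn_if abs_if zero_le_mult_iff mult_less_0_iff)
    have cosh_abs: "cosh (l * \<bar>x\<bar>) = cosh (l * x)" for x
      by (cases "0 \<le> x") auto
    have iS: "integrable M (\<lambda>\<omega>. sinh (l * \<bar>X \<omega>\<bar>))"
    proof (rule Bochner_Integration.integrable_bound[OF is'])
      show "(\<lambda>\<omega>. sinh (l * \<bar>X \<omega>\<bar>)) \<in> borel_measurable M"
        unfolding sinh_field_def by measurable
      show "AE \<omega> in M. norm (sinh (l * \<bar>X \<omega>\<bar>)) \<le> norm (sinh (l * X \<omega>))"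
        by (auto simp: abs_if)
    qed
    have s_le: "\<bar>s\<bar> \<le> \<bar>S\<bar>"
    proof -
      have "\<bar>s\<bar> \<le> expectation (\<lambda>\<omega>. \<bar>sinh (l * X \<omega>)\<bar>)"
        unfolding s_def by (rule integral_abs_bound)
      also have "\<dots> = sgn l * S"
        unfolding sinh_mult_abs S_def by simp
      also have "\<dots> \<le> \<bar>S\<bar>"
        by (auto simp: sgn_if)
      finally show ?thesis .
    qed
    have ex: "exp y = cosh y + sinh y" "exp (- y) = cosh y - sinh y" for y :: real
      by (simp_all add: cosh_plus_sinh cosh_minus_sinh)
    have E1: "expectation (\<lambda>\<omega>. exp (l * X \<omega>)) = C + s"
         and E2: "expectation (\<lambda>\<omega>. exp (- l * X \<omega>)) = C - s"
      using ic is' by (simp_all add: ex C_def s_def)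
    have A1: "expectation (\<lambda>\<omega>. exp (l * \<bar>X \<omega>\<bar>)) = C + S"
         and A2: "expectation (\<lambda>\<omega>. exp (- (l * \<bar>X \<omega>\<bar>))) = C - S"
         and I1: "integrable M (\<lambda>\<omega>. exp (l * \<bar>X \<omega>\<bar>))"
         and I2: "integrable M (\<lambda>\<omega>. exp (- (l * \<bar>X \<omega>\<bar>)))"
      using ic iS by (simp_all add: ex C_def S_def cosh_abs)
    \<comment> \<open>Jensen by hand: the integrand is the tangent line at \<open>?m\<close> of u ->
      exp (- l u), taken at \<open>\<bar>X \<omega>\<bar>\<close>. Its linear term has mean zero,
      and convexity puts the line below the exponential.\<close>
    have "exp (- (l * ?m)) = expectation (\<lambda>\<omega>. exp (- (l * ?m)) * (1 - l * (\<bar>X \<omega>\<bar> - ?m)))"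
      using int by (simp add: prob_space)
    also have "\<dots> \<le> expectation (\<lambda>\<omega>. exp (- (l * \<bar>X \<omega>\<bar>)))"
    proof (rule integral_mono)
      fix \<omega>
      have "exp (- (l * ?m)) * (1 - l * (\<bar>X \<omega>\<bar> - ?m))
          \<le> exp (- (l * ?m)) * exp (- (l * (\<bar>X \<omega>\<bar> - ?m)))"
        using exp_ge_add_one_self[of "- (l * (\<bar>X \<omega>\<bar> - ?m))"] by (intro mult_left_mono) auto
      also have "\<dots> = exp (- (l * \<bar>X \<omega>\<bar>))"
        by (simp add: exp_add[symmetric] algebra_simps)
      finally show "exp (- (l * ?m)) * (1 - l * (\<bar>X \<omega>\<bar> - ?m)) \<le> exp (- (l * \<bar>X \<omega>\<bar>))" .
    qed (use int I2 in auto)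
    finally have jensen: "exp (- (l * ?m)) \<le> C - S" unfolding A2 .
    have split: "exp (l * (\<bar>X \<omega>\<bar> - ?m)) = exp (l * \<bar>X \<omega>\<bar>) * exp (- (l * ?m))" for \<omega>
      by (simp add: exp_add[symmetric] algebra_simps)
    have "expectation (\<lambda>\<omega>. exp (l * (\<bar>X \<omega>\<bar> - ?m))) = (C + S) * exp (- (l * ?m))"
      unfolding split using I1 A1 by simp
    \<comment> \<open>Multiplying the Jensen bound by \<open>C + S\<close> is legitimate because
      \<open>C + S\<close> is itself the mean of an exponential.\<close>
    also have "\<dots> \<le> (C + S) * (C - S)"
      using jensen A1[symmetric] by (intro mult_left_mono) auto
    also have "\<dots> \<le> (C + s) * (C - s)"
      using power_mono[OF s_le, of 2] by (simp add: algebra_simps power2_eq_square)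
    also have "\<dots> \<le> exp (l\<^sup>2 * v / 2) * exp (l\<^sup>2 * v / 2)"
      unfolding E1[symmetric] E2[symmetric]
      using mgf(2)[of l] mgf(2)[of "- l"] l by (intro mult_mono) auto
    also have "\<dots> = exp (l\<^sup>2 * (2 * v) / 2)"
      by (simp add: exp_add[symmetric])
    finally show ?thesis
      unfolding split using I1 by simp
  qed
  then show ?thesis
    using b int unfolding sub_exponential_def by auto
qed

text \<open>Averaging the moment generating function over \<open>h\<close> and \<open>- h\<close>
  cancels the odd terms, so its excess over 1 controls the second moment to order
  \<open>h\<^sup>2\<close>; letting \<open>h\<close> tend to 0 recovers \<open>v\<close>.\<close>

lemma (in prob_space) sub_exponential_expectation_abs_le:
  assumes X: "sub_exponential M X v b" and mean: "expectation X = 0"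
  shows "(expectation (\<lambda>\<omega>. \<bar>X \<omega>\<bar>))\<^sup>2 \<le> v"
proof -
  have b: "0 < b" and int: "integrable M X"
    using X by (auto simp: sub_exponential_def)
  have mgf: "integrable M (\<lambda>\<omega>. exp (l * X \<omega>))"
      "expectation (\<lambda>\<omega>. exp (l * X \<omega>)) \<le> exp (l\<^sup>2 * v / 2)" if "\<bar>l\<bar> \<le> 1 / b" for l
    using X mean that unfolding sub_exponential_def by auto
  define a where "a = expectation (\<lambda>\<omega>. \<bar>X \<omega>\<bar>)"
  have "a\<^sup>2 \<le> 2 * (exp (h\<^sup>2 * v / 2) - 1) / h\<^sup>2" if h: "0 < h" "h < 1 / b" for h
  proof -
    have i: "integrable M (\<lambda>\<omega>. exp (h * X \<omega>))" "integrable M (\<lambda>\<omega>. exp (- h * X \<omega>))"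
      using mgf(1)[of h] mgf(1)[of "- h"] h by auto
    \<comment> \<open>The tangent 2 a u - a^2 of u^2 at \<open>a\<close> replaces the square: its
      mean at u = \<open>\<bar>X \<omega>\<bar>\<close> is \<open>a\<^sup>2\<close>, and being
      affine it requires only integrability of \<open>X\<close>, not of its square.\<close>
    have "2 + h\<^sup>2 * a\<^sup>2 = expectation (\<lambda>\<omega>. 2 + h\<^sup>2 * (2 * a * \<bar>X \<omega>\<bar> - a\<^sup>2))"
      using int by (simp add: prob_space a_def power2_eq_square)
    also have "\<dots> \<le> expectation (\<lambda>\<omega>. exp (h * X \<omega>) + exp (- h * X \<omega>))"
    proof (rule integral_mono)
      fix \<omega>
      have "2 * a * \<bar>X \<omega>\<bar> - a\<^sup>2 \<le> (X \<omega>)\<^sup>2"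
        using zero_le_power2[of "\<bar>X \<omega>\<bar> - a"] by (simp add: power2_diff algebra_simps)
      then have "h\<^sup>2 * (2 * a * \<bar>X \<omega>\<bar> - a\<^sup>2) \<le> h\<^sup>2 * (X \<omega>)\<^sup>2"
        by (rule mult_left_mono) simp
      then show "2 + h\<^sup>2 * (2 * a * \<bar>X \<omega>\<bar> - a\<^sup>2) \<le> exp (h * X \<omega>) + exp (- h * X \<omega>)"
        using two_plus_square_le_exp_plus_exp_minus[of "h * X \<omega>"]
        by (simp add: power_mult_distrib)
    qed (use int i in auto)
    also have "\<dots> \<le> 2 * exp (h\<^sup>2 * v / 2)"
      using mgf(2)[of h] mgf(2)[of "- h"] h i by simp
    finally show ?thesis
      using h by (simp add: field_simps)
  qed
  then have "eventually (\<lambda>h. a\<^sup>2 \<le> 2 * (exp (h\<^sup>2 * v / 2) - 1) / h\<^sup>2) (at_right 0)"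
    using b eventually_at_right_real[of 0 "1 / b"] by (auto elim!: eventually_mono)
  moreover have "((\<lambda>h. 2 * (exp (h\<^sup>2 * v / 2) - 1) / h\<^sup>2) \<longlongrightarrow> v) (at_right 0)"
    by real_asymp
  ultimately show ?thesis
    unfolding a_def by (intro tendsto_lowerbound) auto
qed

section \<open>Bernstein-type tail bound\<close>

lemma (in prob_space) sub_exponential_upper_tail:
  assumes X: "sub_exponential M X v b" and v: "0 \<le> v" and t: "0 < t"
  shows "prob {\<omega> \<in> space M. X \<omega> - expectation X \<ge> t} \<le> exp (- (t\<^sup>2 / (2 * (v + b * t))))"
proof -
  have b: "0 < b" using X by (simp add: sub_exponential_def)
  have D: "0 < v + b * t" using b v t by (simp add: add_nonneg_pos)
  \<comment> \<open>The unconstrained optimum t / v of the Chernoff bound may exceed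
    \<open>1 / b\<close>. Adding \<open>b * t\<close> to the denominator keeps \<open>l\<close>
    admissible for every \<open>t\<close>, covers \<open>v = 0\<close>, and produces the linear term
    of the final exponent.\<close>
  define l where "l = t / (v + b * t)"
  have l: "0 < l" "\<bar>l\<bar> \<le> 1 / b"
    using D v b t by (simp_all add: l_def field_simps)
  have int: "integrable M (\<lambda>\<omega>. exp (l * (X \<omega> - expectation X)))"
    and le: "expectation (\<lambda>\<omega>. exp (l * (X \<omega> - expectation X))) \<le> exp (l\<^sup>2 * v / 2)"
    using X l(2) unfolding sub_exponential_def by blast+
  have "set_integrable M (space M) (\<lambda>\<omega>. exp (l * (X \<omega> - expectation X)))"
    unfolding set_integrable_def by (intro integrable_mult_indicator int) simp
  then have "prob {\<omega> \<in> space M. X \<omega> - expectation X \<ge> t}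
      \<le> exp (- l * t) * (\<integral>\<omega>\<in>space M. exp (l * (X \<omega> - expectation X)) \<partial>M)"
    using l(1) by (intro Chernoff_ineq_ge) auto
  also have "(\<integral>\<omega>\<in>space M. exp (l * (X \<omega> - expectation X)) \<partial>M)
      = expectation (\<lambda>\<omega>. exp (l * (X \<omega> - expectation X)))"
    using int by (simp add: set_integral_space)
  also have "exp (- l * t) * \<dots> \<le> exp (- l * t) * exp (l\<^sup>2 * v / 2)"
    using le by simp
  also have "\<dots> = exp (l\<^sup>2 * v / 2 - l * t)"
    by (simp add: exp_add[symmetric])
  also have "\<dots> \<le> exp (- (t\<^sup>2 / (2 * (v + b * t))))"
  proof -
    have "l\<^sup>2 * v \<le> l\<^sup>2 * (v + b * t)"
      using b t by (intro mult_left_mono) auto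
    also have "\<dots> = l * t"
      using D by (simp add: l_def power2_eq_square)
    finally have "l\<^sup>2 * v / 2 - l * t \<le> - (l * t / 2)" by simp
    then show ?thesis
      by (simp add: l_def power2_eq_square mult.commute)
  qed
  finally show ?thesis .
qed

section \<open>Duality of the sup norm and the l1 norm\<close>

lemma SUP_infnorm_le_inner:
  fixes x :: "'n::finite \<Rightarrow> real"
  assumes "0 \<le> M"
  shows "(SUP \<Gamma>\<in>{\<Gamma> :: real ^ 'n. infnorm \<Gamma> \<le> M}. \<Sum>i\<in>UNIV. \<Gamma> $ i * x i) = M * (\<Sum>i\<in>UNIV. \<bar>x i\<bar>)"
proof (rule cSup_eq_maximum)
  \<comment> \<open>The maximiser aligns each coordinate with the sign of \<open>x i\<close>. Where
    \<open>x i = 0\<close> it is 0, which is still admissible and leaves the sum unchanged.\<close>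
  define \<Gamma> :: "real ^ 'n" where "\<Gamma> = (\<chi> i. M * sgn (x i))"
  have "\<bar>\<Gamma> $ i\<bar> \<le> M" for i
    using assms by (auto simp: \<Gamma>_def sgn_if)
  then have "infnorm \<Gamma> \<le> M"
    unfolding infnorm_cart by (intro cSup_least) auto
  moreover have "(\<Sum>i\<in>UNIV. \<Gamma> $ i * x i) = M * (\<Sum>i\<in>UNIV. \<bar>x i\<bar>)"
    unfolding sum_distrib_left \<Gamma>_def
    by (intro sum.cong) (auto simp: sgn_if)
  ultimately show "M * (\<Sum>i\<in>UNIV. \<bar>x i\<bar>)
      \<in> (\<lambda>\<Gamma>. \<Sum>i\<in>UNIV. \<Gamma> $ i * x i) ` {\<Gamma> :: real ^ 'n. infnorm \<Gamma> \<le> M}"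
    by (metis (mono_tags, lifting) image_eqI mem_Collect_eq)
next
  fix y assume "y \<in> (\<lambda>\<Gamma>. \<Sum>i\<in>UNIV. \<Gamma> $ i * x i) ` {\<Gamma> :: real ^ 'n. infnorm \<Gamma> \<le> M}"
  then obtain \<Gamma> :: "real ^ 'n" where \<Gamma>: "infnorm \<Gamma> \<le> M" and y: "y = (\<Sum>i\<in>UNIV. \<Gamma> $ i * x i)"
    by auto
  have "\<Gamma> $ i * x i \<le> M * \<bar>x i\<bar>" for i
  proof -
    have "\<Gamma> $ i * x i \<le> \<bar>\<Gamma> $ i\<bar> * \<bar>x i\<bar>"
      by (metis abs_ge_self abs_mult)
    also have "\<dots> \<le> M * \<bar>x i\<bar>"
      using component_le_infnorm_cart[of \<Gamma> i] \<Gamma> by (intro mult_right_mono) auto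
    finally show ?thesis .
  qed
  then show "y \<le> M * (\<Sum>i\<in>UNIV. \<bar>x i\<bar>)"
    unfolding y sum_distrib_left by (rule sum_mono)
qed

section \<open>The supremum: parameters, mean and deviation\<close>

theorem propositionC4:
  fixes P :: "'a measure"
    and X :: "'n::finite \<Rightarrow> 'a \<Rightarrow> real"
    and \<sigma> b :: "'n \<Rightarrow> real"
    and M V0 bmax :: real
    and Z :: "'a \<Rightarrow> real"
  defines "V0 \<equiv> sqrt (\<Sum>i\<in>UNIV. (\<sigma> i)\<^sup>2)"
    and "bmax \<equiv> Max (range b)"
    and "Z \<equiv> (\<lambda>\<omega>. SUP \<Gamma>\<in>{\<Gamma> :: real ^ 'n. infnorm \<Gamma> \<le> M}. \<Sum>i\<in>UNIV. \<Gamma> $ i * X i \<omega>)"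
  assumes "prob_space P"
    and "prob_space.indep_vars P (\<lambda>_. borel) X UNIV"
    and "\<And>i. integral\<^sup>L P (X i) = 0"
    and "\<And>i. sub_exponential P (X i) ((\<sigma> i)\<^sup>2) (b i)"
    and "M > 0"
  shows "sub_exponential P Z (8 * M\<^sup>2 * V0\<^sup>2) (2 * sqrt 2 * M * bmax)
    \<and> integral\<^sup>L P Z \<le> M * V0 * sqrt (real CARD('n))
    \<and> (\<forall>t>0. measure P {\<omega> \<in> space P. Z \<omega> - M * V0 * sqrt (real CARD('n)) \<ge> t}
          \<le> exp (- (t\<^sup>2 / (2 * (8 * M\<^sup>2 * V0\<^sup>2 + 2 * sqrt 2 * M * bmax * t)))))"
proof -
  interpret prob_space P by fact
  define A where "A i \<omega> = \<bar>X i \<omega>\<bar>" for i \<omega>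
  have Z: "Z = (\<lambda>\<omega>. M * (\<Sum>i\<in>UNIV. A i \<omega>))"
    unfolding Z_def A_def using \<open>M > 0\<close> by (simp add: SUP_infnorm_le_inner)
  have V0: "V0\<^sup>2 = (\<Sum>i\<in>UNIV. (\<sigma> i)\<^sup>2)" "0 \<le> V0"
    by (simp_all add: V0_def sum_nonneg)
  have b_pos: "0 < b i" for i
    using assms(7)[of i] by (simp add: sub_exponential_def)
  have b_le: "b i \<le> bmax" for i
    by (simp add: bmax_def)
  have bmax: "0 < bmax"
    using b_pos b_le less_le_trans by blast
  have A: "sub_exponential P (A i) (2 * (\<sigma> i)\<^sup>2) (b i)" for i
    unfolding A_def by (rule sub_exponential_abs) (simp_all add: assms)
  have indep: "indep_vars (\<lambda>_. borel) A UNIV"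
    unfolding A_def using assms(5) by (rule indep_vars_compose2) measurable
  have "sub_exponential P (\<lambda>\<omega>. \<Sum>i\<in>UNIV. A i \<omega>) (\<Sum>i\<in>UNIV. 2 * (\<sigma> i)\<^sup>2) bmax"
    using indep A bmax b_le by (intro sub_exponential_sum) auto
  \<comment> \<open>These parameters equal \<open>2 * M\<^sup>2 * V0\<^sup>2\<close> and
    \<open>M * bmax\<close>, both at most the claimed ones, so monotonicity finishes the first
    claim.\<close>
  then have "sub_exponential P Z (M\<^sup>2 * (\<Sum>i\<in>UNIV. 2 * (\<sigma> i)\<^sup>2)) (M * bmax)"
    unfolding Z using \<open>M > 0\<close> by (rule sub_exponential_cmult)
  moreover have "M\<^sup>2 * (\<Sum>i\<in>UNIV. 2 * (\<sigma> i)\<^sup>2) \<le> 8 * M\<^sup>2 * V0\<^sup>2"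
    by (simp add: V0 sum_distrib_left[symmetric] sum_nonneg)
  moreover have "M * bmax \<le> 2 * sqrt 2 * M * bmax"
  proof -
    have "(1::real) \<le> sqrt 2" by simp
    then have "1 \<le> 2 * sqrt (2::real)" by linarith
    then have "1 * (M * bmax) \<le> (2 * sqrt 2) * (M * bmax)"
      using \<open>M > 0\<close> bmax by (intro mult_right_mono) simp_all
    then show ?thesis by (simp add: mult.assoc)
  qed
  ultimately have Zsub: "sub_exponential P Z (8 * M\<^sup>2 * V0\<^sup>2) (2 * sqrt 2 * M * bmax)"
    by (rule sub_exponential_mono)
  \<comment> \<open>The sign of \<open>\<sigma> i\<close> is unrestricted, hence the absolute value
    when taking the root.\<close>
  have "expectation (A i) \<le> \<bar>\<sigma> i\<bar>" for i
    unfolding A_def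
    by (rule power2_le_imp_le)
       (simp_all add: sub_exponential_expectation_abs_le[OF assms(7) assms(6)])
  then have "expectation (\<lambda>\<omega>. \<Sum>i\<in>UNIV. A i \<omega>) \<le> (\<Sum>i\<in>UNIV. \<bar>\<sigma> i\<bar>)"
    using A by (simp add: sub_exponential_def sum_mono)
  \<comment> \<open>Cauchy-Schwarz against the all-ones vector.\<close>
  also have "\<dots> \<le> V0 * sqrt (real CARD('n))"
    by (rule power2_le_imp_le)
       (use sum_squared_le_sum_of_squares[of "\<lambda>i. \<bar>\<sigma> i\<bar>" UNIV] in
         \<open>simp_all add: V0 power_mult_distrib\<close>)
  finally have mean: "expectation Z \<le> M * V0 * sqrt (real CARD('n))"
    unfolding Z using \<open>M > 0\<close> by (simp add: mult.assoc)
  have "prob {\<omega> \<in> space P. Z \<omega> - M * V0 * sqrt (real CARD('n)) \<ge> t}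
      \<le> exp (- (t\<^sup>2 / (2 * (8 * M\<^sup>2 * V0\<^sup>2 + 2 * sqrt 2 * M * bmax * t))))" if "t > 0" for t
  proof -
    \<comment> \<open>Measurability of this supremum over an uncountable set is inherited from the
      closed form of \<open>Z\<close> as a finite sum, through the integrability contained in
      \<open>Zsub\<close>.\<close>
    have [measurable]: "Z \<in> borel_measurable P"
      using Zsub by (auto simp: sub_exponential_def)
    \<comment> \<open>Replacing the upper bound on the mean by the mean itself only enlarges the
      event.\<close>
    have "prob {\<omega> \<in> space P. Z \<omega> - M * V0 * sqrt (real CARD('n)) \<ge> t}
        \<le> prob {\<omega> \<in> space P. Z \<omega> - expectation Z \<ge> t}"
      using mean by (intro finite_measure_mono) auto
    also have "\<dots> \<le> exp (- (t\<^sup>2 / (2 * (8 * M\<^sup>2 * V0\<^sup>2 + 2 * sqrt 2 * M * bmax * t))))"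
      using Zsub that by (intro sub_exponential_upper_tail) auto
    finally show ?thesis .
  qed
  with Zsub mean show ?thesis by blast
qed

end
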